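(* Let $f$ satisfy (f1) and suppose $f_0=+\infty$ and $f_\infty=+\infty$. Then there exists $\lambda^+>0$ such that for every $\lambda\in(0,\lambda^+)$ problem (MO) has two solutions $u_1^+,u_2^+$ which are positive and strictly concave in $(0,1)$. Similarly, there exists $\lambda^->0$ such that for every $\lambda\in(0,\lambda^-)$ problem (MO) has two solutions $u_1^-,u_2^-$ which are negative and strictly convex in $(0,1)$.
   Context: Let $N\ge 1$ be an integer and $f:\mathbb{R}\to\mathbb{R}$ continuous. For $\lambda\ge 0$, problem (MO) is: find $u\in C^2[0,1]$ with $\left((u'(r))^N\right)'=\lambda^N N r^{N-1} f(-u(r))$ for $0<r<1$ and $u'(0)=u(1)=0$. Condition (f1): $f\in C(\mathbb{R},\mathbb{R})$ and $f(s)s^N>0$ for all $s\neq0$. The quantities $f_0,f_\infty\in[0,+\infty]$ are defined by $f_0^N=\lim_{s\to0} f(s)/s^N$ and $f_\infty^N=\lim_{|s|\to+\infty} f(s)/s^N$ (limits assumed to exist in $[0,+\infty]$). *)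

theory Defs
  imports "HOL-Analysis.Analysis"
begin

definition strict_convex_on :: "real set \<Rightarrow> (real \<Rightarrow> real) \<Rightarrow> bool" where
  "strict_convex_on S u \<longleftrightarrow> convex S \<and>
     (\<forall>x\<in>S. \<forall>y\<in>S. \<forall>t::real. x \<noteq> y \<and> 0 < t \<and> t < 1 \<longrightarrow>
        u ((1 - t) * x + t * y) < (1 - t) * u x + t * u y)"

definition strict_concave_on :: "real set \<Rightarrow> (real \<Rightarrow> real) \<Rightarrow> bool" where
  "strict_concave_on S u \<longleftrightarrow> strict_convex_on S (\<lambda>x. - u x)"

definition MO_solution :: "nat \<Rightarrow> (real \<Rightarrow> real) \<Rightarrow> real \<Rightarrow> (real \<Rightarrow> real) \<Rightarrow> bool" where
  "MO_solution N f lam u \<longleftrightarrow>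
     (\<exists>u' u''.
        (\<forall>r\<in>{0..1}. (u has_real_derivative u' r) (at r within {0..1})) \<and>
        (\<forall>r\<in>{0..1}. (u' has_real_derivative u'' r) (at r within {0..1})) \<and>
        continuous_on {0..1} u'' \<and>
        (\<forall>r\<in>{0<..<1}. ((\<lambda>t. (u' t) ^ N) has_real_derivative
              lam ^ N * real N * r ^ (N - 1) * f (- u r)) (at r)) \<and>
        u' 0 = 0 \<and> u 1 = 0)"

end

theory Submission
  imports Defs "HOL-Complex_Analysis.Great_Picard"
begin

text \<open>
  Put \<open>u = - \<sigma> v\<close> with \<open>\<sigma> = 1\<close> for negative and \<open>\<sigma> = - 1\<close> for positive solutions. With
  \<open>h s = \<lambda>\<^sup>N \<sigma>\<^sup>N f (\<sigma> s)\<close>, both cases reduce to a positive \<open>v\<close> with \<open>v 1 = 0\<close> and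
  \<open>v r = a - \<integral>\<^sub>0\<^sup>r (\<integral>\<^sub>0\<^sup>s N t\<^sup>N\<^sup>-\<^sup>1 h (v t) dt)\<^sup>1\<^sup>/\<^sup>N ds\<close>, and one shoots in the initial value \<open>a\<close>.

  Since \<open>f\<close> is only continuous, the initial value problem need not be uniquely solvable. Replacing
  the upper limit \<open>s\<close> by \<open>s - d\<close> (Tonelli's delay) restores uniqueness and continuous dependence
  on \<open>a\<close>. Uniformly in \<open>d\<close>, the terminal value \<open>v 1\<close> is positive for \<open>a = 1\<close> if \<open>\<lambda>\<close> is small, and
  negative for some small \<open>a\<close> (because \<open>f\<^sub>0 = \<infinity>\<close>) and for some large \<open>a\<close> (because
  \<open>f\<^sub>\<infinity> = \<infinity>\<close>). The intermediate value theorem gives two zeros, one on each side of \<open>1\<close>, and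
  the Arzela-Ascoli theorem lets \<open>d\<close> tend to \<open>0\<close>.
\<close>

section \<open>Calculus preliminaries and the target class of profiles\<close>

lemma has_integral_weight:
  fixes x y :: real
  assumes "N \<ge> 1" "x \<le> y"
  shows "((\<lambda>t. real N * t ^ (N - 1)) has_integral (y ^ N - x ^ N)) {x..y}"
  by (rule fundamental_theorem_of_calculus[OF assms(2)])
     (auto intro!: derivative_eq_intros simp: has_real_derivative_iff_has_vector_derivative[symmetric])

text \<open>The mean value theorem on \<open>[x, z]\<close> and on \<open>[z, y]\<close> gives
  secant slopes \<open>\<phi>' p < \<phi>' q\<close>. The two lengths are \<open>t * (y - x)\<close>
  and \<open>(1 - t) * (y - x)\<close>, so multiplying by \<open>t * (1 - t) * (y - x)\<close>
  yields the convexity inequality.\<close>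

lemma strict_convex_on_deriv_strict_mono:
  fixes \<phi> \<phi>' :: "real \<Rightarrow> real"
  assumes deriv: "\<And>x. x \<in> {l<..<u} \<Longrightarrow> (\<phi> has_real_derivative \<phi>' x) (at x)"
    and mono: "\<And>x y. l < x \<Longrightarrow> x < y \<Longrightarrow> y < u \<Longrightarrow> \<phi>' x < \<phi>' y"
  shows "strict_convex_on {l<..<u} \<phi>"
proof -
  have *: "\<phi> ((1 - t) * x + t * y) < (1 - t) * \<phi> x + t * \<phi> y"
    if xy: "l < x" "x < y" "y < u" and t: "0 < t" "t < 1" for x y t
  proof -
    define z where "z = (1 - t) * x + t * y"
    have zx: "z - x = t * (y - x)" and yz: "y - z = (1 - t) * (y - x)"
      by (auto simp: z_def algebra_simps)
    have "0 < z - x" "0 < y - z" unfolding zx yz using t xy by auto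
    then have z: "x < z" "z < y" by auto
    obtain p where p: "x < p" "p < z" "\<phi> z - \<phi> x = (z - x) * \<phi>' p"
      using MVT2[of x z \<phi> \<phi>'] deriv z xy by auto
    obtain q where q: "z < q" "q < y" "\<phi> y - \<phi> z = (y - z) * \<phi>' q"
      using MVT2[of z y \<phi> \<phi>'] deriv z xy by auto
    have "\<phi>' p < \<phi>' q" using p q xy by (intro mono) auto
    then have "(t * (1 - t) * (y - x)) * \<phi>' p < (t * (1 - t) * (y - x)) * \<phi>' q"
      using t xy by (intro mult_strict_left_mono) auto
    then have "(1 - t) * (\<phi> z - \<phi> x) < t * (\<phi> y - \<phi> z)"
      unfolding p(3) q(3) zx yz by (simp add: algebra_simps)
    then show ?thesis unfolding z_def[symmetric] by (simp add: algebra_simps)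
  qed
  show ?thesis
    unfolding strict_convex_on_def
  proof (intro conjI ballI allI impI)
    fix x y t :: real
    assume "x \<in> {l<..<u}" "y \<in> {l<..<u}" "x \<noteq> y \<and> 0 < t \<and> t < 1"
    then show "\<phi> ((1 - t) * x + t * y) < (1 - t) * \<phi> x + t * \<phi> y"
      using *[of x y t] *[of y x "1 - t"] by (cases "x < y") (auto simp: add.commute)
  qed simp
qed

text \<open>With \<open>w\<close> in the role of \<open>- v'\<close>, one equation serves both signs
  of the solution: the sign \<open>\<sigma>\<close> enters only through \<open>h\<close>.\<close>

definition positive_profile :: "nat \<Rightarrow> (real \<Rightarrow> real) \<Rightarrow> (real \<Rightarrow> real) \<Rightarrow> bool" where
  "positive_profile N h v \<longleftrightarrow>
     (\<forall>r\<in>{0<..<1}. 0 < v r) \<and> v 1 = 0 \<and> strict_concave_on {0<..<1} v \<and>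
     (\<exists>w w'.
        (\<forall>r\<in>{0..1}. (v has_real_derivative - w r) (at r within {0..1})) \<and>
        (\<forall>r\<in>{0..1}. (w has_real_derivative w' r) (at r within {0..1})) \<and>
        continuous_on {0..1} w' \<and> w 0 = 0 \<and>
        (\<forall>r\<in>{0<..<1}. ((\<lambda>t. w t ^ N) has_real_derivative
            real N * r ^ (N - 1) * h (v r)) (at r)))"

text \<open>Here \<open>h\<close> will be a truncated nonlinearity. Its sign makes the trajectories
  nonincreasing, and \<open>B\<close> bounds their slopes independently of the delay and of the
  initial value.\<close>

locale delayed_shooting =
  fixes N :: nat and h :: "real \<Rightarrow> real" and B :: real
  assumes N: "N \<ge> 1"
    and h_cont: "continuous_on UNIV h"
    and h_nonneg: "\<And>s. 0 \<le> h s"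
    and h_le: "\<And>s. h s \<le> B"
begin

section \<open>The delayed integral operator: monotonicity and uniform bounds\<close>

definition flux :: "(real \<Rightarrow> real) \<Rightarrow> real \<Rightarrow> real" where
  "flux v s = integral {0..s} (\<lambda>t. real N * t ^ (N - 1) * h (v t))"

text \<open>At a continuous fixed point of \<open>shoot d a\<close> this is \<open>- v'\<close> on
  \<open>[0, 1]\<close>. The \<open>max 0\<close> stops the flux at the origin, so the slope
  vanishes on \<open>[0, d]\<close>.\<close>

definition slope :: "real \<Rightarrow> (real \<Rightarrow> real) \<Rightarrow> real \<Rightarrow> real" where
  "slope d v s = root N (flux v (max 0 (s - d)))"

definition shoot :: "real \<Rightarrow> real \<Rightarrow> (real \<Rightarrow> real) \<Rightarrow> real \<Rightarrow> real" where
  "shoot d a v r = a - integral {0..r} (slope d v)"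

lemma B_nonneg: "0 \<le> B"
  using h_nonneg h_le order_trans by blast

lemma continuous_on_integrand:
  assumes "continuous_on {0..1} v"
  shows "continuous_on {0..1} (\<lambda>t. real N * t ^ (N - 1) * h (v t))"
  using continuous_on_compose2[OF h_cont assms] by (intro continuous_intros) auto

lemma integrand_integrable:
  assumes "continuous_on {0..1} v" "0 \<le> x" "y \<le> 1"
  shows "(\<lambda>t. real N * t ^ (N - 1) * h (v t)) integrable_on {x..y}"
  by (rule integrable_continuous_real)
     (rule continuous_on_subset[OF continuous_on_integrand[OF assms(1)]], use assms in auto)

lemma flux_diff:
  assumes "continuous_on {0..1} v" "0 \<le> x" "x \<le> y" "y \<le> 1"
  shows "flux v y - flux v x = integral {x..y} (\<lambda>t. real N * t ^ (N - 1) * h (v t))"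
  using Henstock_Kurzweil_Integration.integral_combine[of 0 x y "\<lambda>t. real N * t ^ (N - 1) * h (v t)"] integrand_integrable[of v 0 y] assms
  by (simp add: flux_def)

lemma flux_diff_le:
  assumes "continuous_on {0..1} v" "0 \<le> x" "x \<le> y" "y \<le> 1"
    and c: "\<And>t. t \<in> {x..y} \<Longrightarrow> h (v t) \<le> c"
  shows "flux v y - flux v x \<le> c * (y ^ N - x ^ N)"
  unfolding flux_diff[OF assms(1-4)]
proof (rule has_integral_le[OF integrable_integral[OF integrand_integrable[OF assms(1,2,4)]]])
  show "((\<lambda>t. c * (real N * t ^ (N - 1))) has_integral c * (y ^ N - x ^ N)) {x..y}"
    by (rule has_integral_mult_right[OF has_integral_weight[OF N assms(3)]])
  show "real N * t ^ (N - 1) * h (v t) \<le> c * (real N * t ^ (N - 1))" if "t \<in> {x..y}" for t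
    using mult_right_mono[OF c[OF that], of "real N * t ^ (N - 1)"] that assms(2) by (simp add: mult.commute)
qed

lemma flux_diff_ge:
  assumes "continuous_on {0..1} v" "0 \<le> x" "x \<le> y" "y \<le> 1"
    and c: "\<And>t. t \<in> {x..y} \<Longrightarrow> c \<le> h (v t)"
  shows "c * (y ^ N - x ^ N) \<le> flux v y - flux v x"
  unfolding flux_diff[OF assms(1-4)]
proof (rule has_integral_le[OF _ integrable_integral[OF integrand_integrable[OF assms(1,2,4)]]])
  show "((\<lambda>t. c * (real N * t ^ (N - 1))) has_integral c * (y ^ N - x ^ N)) {x..y}"
    by (rule has_integral_mult_right[OF has_integral_weight[OF N assms(3)]])
  show "c * (real N * t ^ (N - 1)) \<le> real N * t ^ (N - 1) * h (v t)" if "t \<in> {x..y}" for t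
    using mult_right_mono[OF c[OF that], of "real N * t ^ (N - 1)"] that assms(2) by (simp add: mult.commute)
qed

lemma flux_0 [simp]: "flux v 0 = 0"
  by (simp add: flux_def)

lemma flux_mono:
  assumes "continuous_on {0..1} v" "0 \<le> x" "x \<le> y" "y \<le> 1"
  shows "flux v x \<le> flux v y"
  using flux_diff_ge[OF assms, of 0] h_nonneg by simp

lemma flux_nonneg:
  assumes "continuous_on {0..1} v" "0 \<le> x" "x \<le> 1"
  shows "0 \<le> flux v x"
  using flux_mono[of v 0 x] assms by simp

lemma flux_le:
  assumes "continuous_on {0..1} v" "0 \<le> x" "x \<le> 1"
    and c: "\<And>t. t \<in> {0..x} \<Longrightarrow> h (v t) \<le> c"
  shows "flux v x \<le> c * x ^ N"
  using flux_diff_le[of v 0 x c] assms N by (simp add: power_0_left)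

lemma flux_ge:
  assumes "continuous_on {0..1} v" "0 \<le> x" "x \<le> 1"
    and c: "\<And>t. t \<in> {0..x} \<Longrightarrow> c \<le> h (v t)"
  shows "c * x ^ N \<le> flux v x"
  using flux_diff_ge[of v 0 x c] assms N by (simp add: power_0_left)

lemma continuous_on_flux:
  assumes "continuous_on {0..1} v"
  shows "continuous_on {0..1} (flux v)"
  unfolding flux_def
  by (rule indefinite_integral_continuous_1[OF integrand_integrable]) (use assms in auto)

lemma continuous_on_slope:
  assumes "continuous_on {0..1} v" "0 \<le> d"
  shows "continuous_on {0..1} (slope d v)"
  unfolding slope_def
  by (intro continuous_on_real_root continuous_on_compose2[OF continuous_on_flux[OF assms(1)]] continuous_intros)
     (use assms in auto)

lemma slope_integrable:
  assumes "continuous_on {0..1} v" "0 \<le> d" "0 \<le> x" "y \<le> 1"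
  shows "slope d v integrable_on {x..y}"
  by (rule integrable_continuous_real)
     (rule continuous_on_subset[OF continuous_on_slope[OF assms(1,2)]], use assms in auto)

lemma slope_nonneg:
  assumes "continuous_on {0..1} v" "0 \<le> d" "x \<le> 1"
  shows "0 \<le> slope d v x"
  unfolding slope_def using assms by (intro real_root_pos_pos_le flux_nonneg) auto

text \<open>The flux and the shifted radius are both monotone. This is the concavity of
  \<open>shoot d a v\<close>, which allows drops over different subintervals to be compared.\<close>

lemma slope_mono:
  assumes "continuous_on {0..1} v" "0 \<le> d" "x \<le> y" "y \<le> 1"
  shows "slope d v x \<le> slope d v y"
  unfolding slope_def using N assms by (intro real_root_le_mono flux_mono) auto

lemma slope_le:
  assumes "continuous_on {0..1} v" "0 \<le> d" "x \<le> 1" "0 \<le> c"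
    and c: "\<And>t. t \<in> {0..1} \<Longrightarrow> h (v t) \<le> c"
  shows "slope d v x \<le> root N c"
proof -
  have "flux v (max 0 (x - d)) \<le> c * max 0 (x - d) ^ N"
    by (rule flux_le) (use assms in auto)
  also have "\<dots> \<le> c * 1"
    using assms by (intro mult_left_mono power_le_one) auto
  finally show ?thesis
    unfolding slope_def using N by (intro real_root_le_mono) auto
qed

lemma slope_le_bound:
  assumes "continuous_on {0..1} v" "0 \<le> d" "x \<le> 1"
  shows "slope d v x \<le> root N B"
  by (rule slope_le) (use assms h_le B_nonneg in auto)

lemma shoot_0 [simp]: "shoot d a v 0 = a"
  by (simp add: shoot_def)

lemma shoot_diff:
  assumes "continuous_on {0..1} v" "0 \<le> d" "0 \<le> x" "x \<le> y" "y \<le> 1"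
  shows "shoot d a v x - shoot d a v y = integral {x..y} (slope d v)"
  using Henstock_Kurzweil_Integration.integral_combine[of 0 x y "slope d v"] slope_integrable[of v d 0 y] assms
  by (simp add: shoot_def)

lemma shoot_diff_le:
  assumes "continuous_on {0..1} v" "0 \<le> d" "0 \<le> x" "x \<le> y" "y \<le> 1"
    and c: "\<And>t. t \<in> {x..y} \<Longrightarrow> slope d v t \<le> c"
  shows "shoot d a v x - shoot d a v y \<le> c * (y - x)"
  unfolding shoot_diff[OF assms(1-5)]
  using integral_le[OF slope_integrable[OF assms(1,2,3,5)] integrable_const_ivl, of c] c assms(4)
  by (simp add: mult.commute)

lemma shoot_diff_ge:
  assumes "continuous_on {0..1} v" "0 \<le> d" "0 \<le> x" "x \<le> y" "y \<le> 1"
    and c: "\<And>t. t \<in> {x..y} \<Longrightarrow> c \<le> slope d v t"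
  shows "c * (y - x) \<le> shoot d a v x - shoot d a v y"
  unfolding shoot_diff[OF assms(1-5)]
  using integral_le[OF integrable_const_ivl slope_integrable[OF assms(1,2,3,5)], of c] c assms(4)
  by (simp add: mult.commute)

lemma shoot_antimono:
  assumes "continuous_on {0..1} v" "0 \<le> d" "0 \<le> x" "x \<le> y" "y \<le> 1"
  shows "shoot d a v y \<le> shoot d a v x"
  using shoot_diff_ge[OF assms, of 0] slope_nonneg assms by auto

text \<open>All slopes lie between \<open>0\<close> and \<open>root N B\<close>. The constant does
  not depend on \<open>d\<close>, \<open>a\<close> or \<open>v\<close>, which supplies the
  equicontinuity for Arzela-Ascoli.\<close>

lemma shoot_lipschitz:
  assumes "continuous_on {0..1} v" "0 \<le> d" "x \<in> {0..1}" "y \<in> {0..1}"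
  shows "\<bar>shoot d a v x - shoot d a v y\<bar> \<le> root N B * \<bar>x - y\<bar>"
proof -
  have *: "\<bar>shoot d a v x - shoot d a v y\<bar> \<le> root N B * (y - x)"
    if "0 \<le> x" "x \<le> y" "y \<le> 1" for x y
    using shoot_diff_le[OF assms(1,2) that, of "root N B"] shoot_antimono[OF assms(1,2) that, of a]
      slope_le_bound[OF assms(1,2)] that by auto
  show ?thesis
    using *[of x y] *[of y x] assms by (cases "x \<le> y") (auto simp: abs_minus_commute)
qed

section \<open>Continuity of the operator under pointwise limits\<close>

lemma continuous_on_shoot:
  assumes "continuous_on {0..1} v" "0 \<le> d"
  shows "continuous_on {0..1} (shoot d a v)"
  unfolding shoot_def
  by (intro continuous_intros indefinite_integral_continuous_1 slope_integrable) (use assms in auto)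

text \<open>For a fixed upper limit this is dominated convergence with majorant
  \<open>N * B\<close>. Moving the upper limit from \<open>x\<close> to \<open>X j\<close> costs at
  most \<open>B * \<bar>X j ^ N - x ^ N\<bar>\<close>, uniformly in the function.\<close>

lemma flux_tendsto:
  assumes vj: "\<And>j::nat. continuous_on {0..1} (V j)"
    and lim: "\<And>r. r \<in> {0..1} \<Longrightarrow> (\<lambda>j. V j r) \<longlonglongrightarrow> v r"
    and xj: "X \<longlonglongrightarrow> x" "\<And>j. X j \<in> {0..1}"
  shows "(\<lambda>j. flux (V j) (X j)) \<longlonglongrightarrow> flux v x"
proof -
  have x: "x \<in> {0..1}"
    using LIMSEQ_le_const[OF xj(1), of 0] LIMSEQ_le_const2[OF xj(1), of 1] xj(2) by auto
  have 1: "(\<lambda>j. flux (V j) x) \<longlonglongrightarrow> flux v x"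
    unfolding flux_def
  proof (rule dominated_convergence(2))
    show "(\<lambda>t. real N * B) integrable_on {0..x}" by (rule integrable_const_ivl)
    show "(\<lambda>j. real N * t ^ (N - 1) * h (V j t)) \<longlonglongrightarrow> real N * t ^ (N - 1) * h (v t)"
      if "t \<in> {0..x}" for t
      using that x lim[of t] h_cont
      by (intro tendsto_mult tendsto_const) (auto intro: continuous_on_tendsto_compose)
    show "norm (real N * t ^ (N - 1) * h (V j t)) \<le> real N * B" if "t \<in> {0..x}" for t j
    proof -
      have "t ^ (N - 1) * h (V j t) \<le> 1 * B"
        using that x h_nonneg h_le by (intro mult_mono power_le_one) auto
      then have "real N * (t ^ (N - 1) * h (V j t)) \<le> real N * B"
        by (intro mult_left_mono) auto
      then show ?thesis using that h_nonneg[of "V j t"] by (simp add: abs_mult mult.assoc)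
    qed
    show "(\<lambda>t. real N * t ^ (N - 1) * h (V j t)) integrable_on {0..x}" for j
      by (rule integrand_integrable[OF vj]) (use x in auto)
  qed
  have *: "\<bar>flux (V j) y - flux (V j) z\<bar> \<le> B * \<bar>y ^ N - z ^ N\<bar>"
    if "0 \<le> y" "y \<le> z" "z \<le> 1" for j y z
    using flux_diff_le[OF vj that h_le] flux_mono[OF vj that] power_mono[OF that(2,1), of N] by simp
  have 2: "\<bar>flux (V j) (X j) - flux (V j) x\<bar> \<le> B * \<bar>X j ^ N - x ^ N\<bar>" for j
    using *[of "X j" x j] *[of x "X j" j] xj(2)[of j] x
    by (cases "X j \<le> x") (auto simp: abs_minus_commute)
  have "(\<lambda>j. B * \<bar>X j ^ N - x ^ N\<bar>) \<longlonglongrightarrow> B * \<bar>x ^ N - x ^ N\<bar>"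
    by (intro tendsto_intros xj)
  then have "(\<lambda>j. flux (V j) (X j) - flux (V j) x) \<longlonglongrightarrow> 0"
    using 2 by (auto intro: Lim_null_comparison[where g = "\<lambda>j. B * \<bar>X j ^ N - x ^ N\<bar>"])
  from tendsto_add[OF this 1] show ?thesis by simp
qed

text \<open>Joint continuity in delay, initial value and function, by dominated convergence of the
  slopes. It serves once with a fixed delay, for dependence on the initial value, and once with
  delays tending to \<open>0\<close>.\<close>

lemma shoot_tendsto:
  assumes vj: "\<And>j::nat. continuous_on {0..1} (V j)"
    and lim: "\<And>r. r \<in> {0..1} \<Longrightarrow> (\<lambda>j. V j r) \<longlonglongrightarrow> v r"
    and D: "D \<longlonglongrightarrow> d" "\<And>j. 0 \<le> D j"
    and A: "A \<longlonglongrightarrow> a" and r: "r \<in> {0..1}"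
  shows "(\<lambda>j. shoot (D j) (A j) (V j) r) \<longlonglongrightarrow> shoot d a v r"
  unfolding shoot_def
proof (intro tendsto_diff A dominated_convergence(2))
  show "(\<lambda>t. root N B) integrable_on {0..r}" by (rule integrable_const_ivl)
  show "(\<lambda>j. slope (D j) (V j) s) \<longlonglongrightarrow> slope d v s" if "s \<in> {0..r}" for s
  proof -
    have "max 0 (s - D j) \<in> {0..1}" for j using that r D(2)[of j] by auto
    then show ?thesis
      unfolding slope_def
      by (intro tendsto_real_root flux_tendsto vj lim tendsto_intros D) auto
  qed
  show "norm (slope (D j) (V j) s) \<le> root N B" if "s \<in> {0..r}" for s j
    using slope_nonneg[OF vj D(2), of s] slope_le_bound[OF vj D(2), of s] that r by auto
  show "slope (D j) (V j) integrable_on {0..r}" for j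
    by (rule slope_integrable[OF vj D(2)]) (use r in auto)
qed

lemma shoot_cong:
  assumes "0 < d" "r \<in> {0..1}" and eq: "\<And>t. t \<in> {0..1} \<Longrightarrow> t \<le> r - d \<Longrightarrow> v t = w t"
  shows "shoot d a v r = shoot d a w r"
proof -
  have "slope d v s = slope d w s" if "s \<in> {0..r}" for s
    unfolding slope_def flux_def
    using that assms
    \<comment> \<open>For \<open>s \<le> d\<close> both fluxes are integrals over the single point
      \<open>0\<close> and vanish, even where \<open>eq\<close> says nothing about the value at
      \<open>0\<close>.\<close>
    by (cases "s \<le> d")
       (auto intro!: arg_cong[where f = "root N"] Henstock_Kurzweil_Integration.integral_cong simp: max_def)
  then show ?thesis
    unfolding shoot_def by (metis (mono_tags, lifting) Henstock_Kurzweil_Integration.integral_cong)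
qed

section \<open>Fixed points by iteration, shooting and vanishing delay\<close>

definition iterate :: "real \<Rightarrow> real \<Rightarrow> nat \<Rightarrow> real \<Rightarrow> real" where
  "iterate d a k = (shoot d a ^^ k) (\<lambda>_. a)"

lemma iterate_0 [simp]: "iterate d a 0 = (\<lambda>_. a)"
  by (simp add: iterate_def)

lemma iterate_Suc [simp]: "iterate d a (Suc k) = shoot d a (iterate d a k)"
  by (simp add: iterate_def)

lemma continuous_on_iterate: "0 \<le> d \<Longrightarrow> continuous_on {0..1} (iterate d a k)"
  by (induction k) (auto intro: continuous_on_shoot)

text \<open>The delay makes the values on \<open>[0, (k + 1) d]\<close> depend only on those on \<open>[0, k d]\<close>, so
  the iteration becomes stationary after finitely many steps.\<close>

lemma iterate_stationary:
  assumes "0 < d" "r \<in> {0..1}" "r \<le> real k * d"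
  shows "iterate d a (Suc k) r = iterate d a k r"
  using assms(2,3)
proof (induction k arbitrary: r)
  case 0
  then show ?case by (simp add: shoot_def)
next
  case (Suc k)
  have "shoot d a (iterate d a (Suc k)) r = shoot d a (iterate d a k) r"
    by (rule shoot_cong) (use Suc assms(1) in \<open>auto simp: algebra_simps simp del: iterate_Suc\<close>)
  then show ?case by simp
qed

text \<open>Induction on the fixed number \<open>k\<close> of steps; this is the continuity in
  \<open>a\<close> required by the intermediate value theorem.\<close>

lemma iterate_tendsto:
  assumes "0 \<le> d" "A \<longlonglongrightarrow> a" "r \<in> {0..1}"
  shows "(\<lambda>j. iterate d (A j) k r) \<longlonglongrightarrow> iterate d a k r"
  using assms(3)
proof (induction k arbitrary: r)
  case (Suc k)
  show ?case
    unfolding iterate_Suc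
    by (intro shoot_tendsto) (use Suc assms in \<open>auto intro: continuous_on_iterate\<close>)
qed (use assms in simp)

text \<open>A trajectory never exceeds its initial value \<open>a\<close>, so \<open>h\<close> stays
  below \<open>c\<close> along it and the total drop on \<open>[0, 1]\<close> is at most
  \<open>root N c < a\<close>. The case \<open>d = 0\<close> is included for later use.\<close>

lemma fixed_point_end_pos:
  assumes v: "continuous_on {0..1} v" and d: "0 \<le> d"
    and fp: "\<And>r. r \<in> {0..1} \<Longrightarrow> v r = shoot d a v r"
    and c: "0 \<le> c" "\<And>s. s \<le> a \<Longrightarrow> h s \<le> c" "root N c < a"
  shows "0 < v 1"
proof -
  have "v t \<le> a" if "t \<in> {0..1}" for t
    using shoot_antimono[OF v d, of 0 t a] fp[OF that] that by auto
  then have "slope d v t \<le> root N c" if "t \<le> 1" for t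
    by (intro slope_le) (use that v d c in auto)
  then have "shoot d a v 0 - shoot d a v 1 \<le> root N c * (1 - 0)"
    by (intro shoot_diff_le v d) auto
  then show ?thesis using fp[of 1] c(3) by auto
qed

text \<open>The function is concave, so if it stayed nonnegative it would be at least \<open>a / 2\<close> on
  \<open>[0, 1 / 2]\<close>; then it descends by more than \<open>a\<close> on \<open>[3 / 4, 1]\<close>.\<close>

lemma fixed_point_end_neg:
  assumes v: "continuous_on {0..1} v" and d: "0 \<le> d" "d \<le> 1 / 4"
    and fp: "\<And>r. r \<in> {0..1} \<Longrightarrow> v r = shoot d a v r"
    and a: "0 < a" "\<And>s. a / 2 \<le> s \<Longrightarrow> s \<le> a \<Longrightarrow> (9 * a) ^ N \<le> h s"
  shows "v 1 < 0"
proof (rule ccontr)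
  assume "\<not> v 1 < 0"
  then have v1: "0 \<le> v 1" by simp
  have anti: "v y \<le> v x" if "0 \<le> x" "x \<le> y" "y \<le> 1" for x y
    using shoot_antimono[OF v d(1) that, of a] fp[of x] fp[of y] that by auto
  have v0: "v 0 = a" using fp[of 0] by simp
  let ?w = "slope d v (1/2)"
  \<comment> \<open>Slopes are at most \<open>?w\<close> before the midpoint and at least
    \<open>?w\<close> after it, so the first half carries at most half of the total drop, which is
    at most \<open>a\<close>.\<close>
  have "shoot d a v 0 - shoot d a v (1/2) \<le> ?w * (1/2 - 0)"
    by (intro shoot_diff_le v d slope_mono) auto
  moreover have "?w * (1 - 1/2) \<le> shoot d a v (1/2) - shoot d a v 1"
    by (intro shoot_diff_ge v d slope_mono) auto
  ultimately have half: "a / 2 \<le> v (1/2)"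
    using fp[of "1/2"] fp[of 1] v1 by simp
  have "(9 * a) ^ N * (1/2) ^ N \<le> flux v (1/2)"
  proof (rule flux_ge[OF v])
    show "(9 * a) ^ N \<le> h (v t)" if "t \<in> {0..1/2}" for t
      using that anti[of t "1/2"] anti[of 0 t] half v0 by (intro a) auto
  qed auto
  then have fl: "(9 * a / 2) ^ N \<le> flux v (1/2)"
    by (simp add: power_divide)
  \<comment> \<open>As \<open>d \<le> 1/4\<close>, the delayed radius \<open>t - d\<close> is at
    least \<open>1/2\<close>, where the flux bound is available. The factor \<open>9\<close> makes
    the drop on the last quarter \<open>9 * a / 8\<close>, more than \<open>a\<close>.\<close>
  have "9 * a / 2 \<le> slope d v t" if "t \<in> {3/4..1}" for t
  proof -
    have "root N ((9 * a / 2) ^ N) \<le> root N (flux v (max 0 (t - d)))"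
      using fl flux_mono[OF v, of "1/2" "max 0 (t - d)"] that d N by (intro real_root_le_mono) auto
    then show ?thesis using N a(1) by (simp add: slope_def real_root_power_cancel)
  qed
  then have "9 * a / 2 * (1 - 3/4) \<le> shoot d a v (3/4) - shoot d a v 1"
    by (intro shoot_diff_ge v d) auto
  then have "9 * a / 8 \<le> v (3/4) - v 1"
    using fp[of "3/4"] fp[of 1] by simp
  then show False
    using anti[of 0 "3/4"] v0 v1 a(1) by simp
qed

text \<open>The intermediate value theorem applied to the terminal value as a function of the
  initial value: it is negative at \<open>\<alpha>\<close> and positive at \<open>\<beta>\<close>. A
  closed segment leaves the order of \<open>\<alpha>\<close> and \<open>\<beta>\<close> open, so the
  lemma serves on both sides of \<open>\<beta>\<close>.\<close>

lemma delayed_solution_exists: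
  assumes d: "0 < d" "d \<le> 1 / 4"
    and \<alpha>: "0 < \<alpha>" "\<And>s. \<alpha> / 2 \<le> s \<Longrightarrow> s \<le> \<alpha> \<Longrightarrow> (9 * \<alpha>) ^ N \<le> h s"
    and c: "0 \<le> c" "\<And>s. s \<le> \<beta> \<Longrightarrow> h s \<le> c" "root N c < \<beta>"
  shows "\<exists>a\<in>closed_segment \<alpha> \<beta>. \<exists>v. continuous_on {0..1} v \<and>
           (\<forall>r\<in>{0..1}. v r = shoot d a v r) \<and> v 1 = 0"
proof -
  \<comment> \<open>With \<open>k * d \<ge> 1\<close> the \<open>k\<close>-th iterate is an exact
    fixed point on all of \<open>[0, 1]\<close>, for every initial value at once.\<close>
  obtain k :: nat where "1 / d < real k" using reals_Archimedean2 by blast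
  then have k: "1 \<le> real k * d" using d(1) by (simp add: field_simps)
  have fp: "iterate d a k r = shoot d a (iterate d a k) r" if "r \<in> {0..1}" for a r
    using iterate_stationary[of d r k a] that k d by auto
  note cont = continuous_on_iterate[OF less_imp_le[OF d(1)], of _ k]
  have "continuous_on (closed_segment \<alpha> \<beta>) (\<lambda>a. iterate d a k 1)"
    unfolding continuous_on_sequentially
    using iterate_tendsto[of d _ _ 1 k] d by (auto simp: o_def)
  then have "connected ((\<lambda>a. iterate d a k 1) ` closed_segment \<alpha> \<beta>)"
    by (intro connected_continuous_image) auto
  moreover have "iterate d \<alpha> k 1 \<in> (\<lambda>a. iterate d a k 1) ` closed_segment \<alpha> \<beta>"
    "iterate d \<beta> k 1 \<in> (\<lambda>a. iterate d a k 1) ` closed_segment \<alpha> \<beta>"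
    by (intro imageI ends_in_segment)+
  moreover have "iterate d \<alpha> k 1 < 0"
    by (rule fixed_point_end_neg[OF cont less_imp_le[OF d(1)] d(2) fp \<alpha>])
  moreover have "0 < iterate d \<beta> k 1"
    by (rule fixed_point_end_pos[OF cont less_imp_le[OF d(1)] fp c])
  ultimately have "0 \<in> (\<lambda>a. iterate d a k 1) ` closed_segment \<alpha> \<beta>"
    by (meson connectedD_interval less_imp_le)
  then obtain a where "a \<in> closed_segment \<alpha> \<beta>" "iterate d a k 1 = 0" by force
  then show ?thesis using cont[of a] fp[of _ a] by blast
qed

text \<open>The bounds at \<open>\<alpha>\<close> and \<open>\<beta>\<close> do not involve the
  delay, so delayed solutions exist along a sequence of delays tending to \<open>0\<close>, and a
  subsequence converges uniformly. Excluding \<open>\<beta>\<close> keeps solutions from the two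
  sides distinct.\<close>

lemma solution_exists:
  assumes \<alpha>: "0 < \<alpha>" "\<And>s. \<alpha> / 2 \<le> s \<Longrightarrow> s \<le> \<alpha> \<Longrightarrow> (9 * \<alpha>) ^ N \<le> h s"
    and c: "0 \<le> c" "\<And>s. s \<le> \<beta> \<Longrightarrow> h s \<le> c" "root N c < \<beta>"
  shows "\<exists>a\<in>closed_segment \<alpha> \<beta> - {\<beta>}. \<exists>v. continuous_on {0..1} v \<and>
           (\<forall>r\<in>{0..1}. v r = shoot 0 a v r) \<and> v 1 = 0"
proof -
  define D where "D n = 1 / 4 * inverse (real (Suc n))" for n :: nat
  have D: "0 < D n" "D n \<le> 1 / 4" for n by (auto simp: D_def field_simps)
  have "\<forall>n. \<exists>a v. a \<in> closed_segment \<alpha> \<beta> \<and> continuous_on {0..1} v \<and>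
           (\<forall>r\<in>{0..1}. v r = shoot (D n) a v r) \<and> v 1 = 0"
    using delayed_solution_exists[OF D \<alpha> c] by blast
  then obtain A V where A: "\<And>n. A n \<in> closed_segment \<alpha> \<beta>"
    and V: "\<And>n. continuous_on {0..1} (V n)"
      "\<And>n r. r \<in> {0..1} \<Longrightarrow> V n r = shoot (D n) (A n) (V n) r" "\<And>n. V n 1 = 0"
    by metis
  \<comment> \<open>Adding \<open>1\<close> makes \<open>L\<close> positive, so that
    \<open>e / L\<close> can serve as the modulus of equicontinuity.\<close>
  define L where "L = root N B + 1"
  have L: "0 < L" using real_root_pos_pos_le[OF B_nonneg, of N] by (simp add: L_def)
  have lip: "\<bar>V n x - V n y\<bar> \<le> L * \<bar>x - y\<bar>" if "x \<in> {0..1}" "y \<in> {0..1}" for n x y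
  proof -
    have "\<bar>V n x - V n y\<bar> \<le> root N B * \<bar>x - y\<bar>"
      using shoot_lipschitz[OF V(1)[of n] less_imp_le[OF D(1)[of n]] that, of "A n"] V(2) that by metis
    also have "\<dots> \<le> L * \<bar>x - y\<bar>" by (simp add: L_def mult_right_mono)
    finally show ?thesis .
  qed
  obtain v k where v: "continuous_on {0..1} v" and k: "strict_mono (k :: nat \<Rightarrow> nat)"
    and unif: "\<And>e. 0 < e \<Longrightarrow> \<exists>M. \<forall>n x. n \<ge> M \<and> x \<in> {0..1} \<longrightarrow> norm (V (k n) x - v x) < e"
  proof (rule Arzela_Ascoli[of "{0..1}" V L])
    \<comment> \<open>The common zero at \<open>1\<close> turns the Lipschitz bound into a uniform
      bound.\<close>
    show "norm (V n x) \<le> L" if "x \<in> {0..1}" for n x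
    proof -
      have "\<bar>V n x\<bar> \<le> L * \<bar>x - 1\<bar>" using lip[of x 1 n] V(3) that by simp
      also have "\<dots> \<le> L * 1" using that L by (intro mult_left_mono) auto
      finally show ?thesis by simp
    qed
    show "\<exists>d>0. \<forall>n y. y \<in> {0..1} \<and> norm (x - y) < d \<longrightarrow> norm (V n x - V n y) < e"
      if "x \<in> {0..1}" "0 < e" for x e
    proof (intro exI[of _ "e / L"] conjI allI impI)
      fix n y assume "y \<in> {0..1} \<and> norm (x - y) < e / L"
      then have "y \<in> {0..1}" "L * \<bar>x - y\<bar> < e" using L by (auto simp: field_simps)
      then show "norm (V n x - V n y) < e" using lip[of x y n] that by simp
    qed (use that L in simp)
  qed auto
  have lim: "(\<lambda>n. V (k n) r) \<longlonglongrightarrow> v r" if "r \<in> {0..1}" for r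
    unfolding LIMSEQ_iff using unif that by blast
  define a where "a = v 0"
  \<comment> \<open>The initial values are values of the functions, so they converge along the same
    subsequence.\<close>
  have "A n = V n 0" for n using V(2)[of 0 n] by simp
  then have Alim: "(\<lambda>n. A (k n)) \<longlonglongrightarrow> a"
    using lim[of 0] by (simp add: a_def)
  have "D \<longlonglongrightarrow> 0"
    unfolding D_def by (intro tendsto_mult_right_zero LIMSEQ_inverse_real_of_nat)
  then have Dlim: "(\<lambda>n. D (k n)) \<longlonglongrightarrow> 0"
    using LIMSEQ_subseq_LIMSEQ[OF _ k] by (auto simp: o_def)
  have fp: "v r = shoot 0 a v r" if r: "r \<in> {0..1}" for r
  proof (rule LIMSEQ_unique[OF lim[OF r]])
    have "(\<lambda>n. shoot (D (k n)) (A (k n)) (V (k n)) r) \<longlonglongrightarrow> shoot 0 a v r"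
      by (intro shoot_tendsto V lim Dlim Alim r less_imp_le[OF D(1)])
    then show "(\<lambda>n. V (k n) r) \<longlonglongrightarrow> shoot 0 a v r" using V(2)[OF r] by simp
  qed
  have v1: "v 1 = 0" using lim[of 1] V(3) by (simp add: LIMSEQ_const_iff)
  have "a \<in> closed_segment \<alpha> \<beta>"
    using closed_sequentially[OF closed_segment, of "\<lambda>n. A (k n)"] A Alim by blast
  \<comment> \<open>The limit of the \<open>A n\<close> could reach the end of the segment, but a
    trajectory without delay from \<open>\<beta>\<close> ends at a positive value.\<close>
  moreover have "a \<noteq> \<beta>"
    using fixed_point_end_pos[OF v order_refl fp c(1)] c v1 by auto
  ultimately show ?thesis using v fp v1 by blast
qed

section \<open>Regularity and strict concavity of fixed points without delay\<close>

lemma flux_has_derivative_within: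
  assumes "continuous_on {0..1} v" "r \<in> {0..1}"
  shows "(flux v has_real_derivative real N * r ^ (N - 1) * h (v r)) (at r within {0..1})"
  unfolding flux_def[abs_def]
  by (rule integral_has_real_derivative[OF continuous_on_integrand[OF assms(1)] assms(2)])

lemma flux_has_derivative:
  assumes "continuous_on {0..1} v" "r \<in> {0<..<1}"
  shows "(flux v has_real_derivative real N * r ^ (N - 1) * h (v r)) (at r)"
  using flux_has_derivative_within[OF assms(1), of r] assms(2)
  by (auto simp: at_within_Icc_at)

text \<open>Near the origin \<open>h (v t)\<close> is at least \<open>h (v 0) / 2\<close>, which
  makes the flux positive there; monotonicity carries this to larger radii.\<close>

lemma flux_pos:
  assumes v: "continuous_on {0..1} v" and h0: "0 < h (v 0)" and r: "0 < r" "r \<le> 1"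
  shows "0 < flux v r"
proof -
  have "continuous_on {0..1} (\<lambda>t. h (v t))"
    using continuous_on_compose2[OF h_cont v] by auto
  then obtain \<delta> where \<delta>: "0 < \<delta>"
    and close: "\<And>t. t \<in> {0..1} \<Longrightarrow> dist t 0 < \<delta> \<Longrightarrow> dist (h (v t)) (h (v 0)) < h (v 0) / 2"
    using h0 unfolding continuous_on_iff by (metis atLeastAtMost_iff half_gt_zero order_refl zero_le_one)
  define x where "x = min r (\<delta> / 2)"
  have x: "0 < x" "x \<le> r" "x < \<delta>" using r \<delta> by (auto simp: x_def)
  have "h (v 0) / 2 * x ^ N \<le> flux v x"
  proof (rule flux_ge[OF v])
    show "h (v 0) / 2 \<le> h (v t)" if "t \<in> {0..x}" for t
      using close[of t] that x r by (auto simp: dist_real_def abs_if split: if_splits)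
  qed (use x r in auto)
  moreover have "0 < h (v 0) / 2 * x ^ N" using h0 x by simp
  moreover have "flux v x \<le> flux v r" using x r by (intro flux_mono v) auto
  ultimately show ?thesis by linarith
qed

lemma slope_0_eq: "0 \<le> r \<Longrightarrow> slope 0 v r = root N (flux v r)"
  by (simp add: slope_def)

text \<open>The chain rule for the root fails at the origin when \<open>N > 1\<close>, where the
  flux vanishes. L'Hopital's rule compares the flux with \<open>x ^ N\<close> instead, and the limit
  provides the derivative of the slope at \<open>0\<close>.\<close>

lemma slope_over_radius_tendsto:
  assumes v: "continuous_on {0..1} v"
  shows "((\<lambda>r. slope 0 v r / r) \<longlongrightarrow> root N (h (v 0))) (at 0 within {0..1})"
proof -
  have at0: "at 0 within {0..1} = at_right (0::real)"
    by (rule at_within_Icc_at_right) simp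
  have ev: "eventually (\<lambda>x::real. x \<in> {0<..<1}) (at_right 0)"
    by (rule eventually_at_right_real) simp
  have hv: "continuous_on {0..1} (\<lambda>t. h (v t))"
    using continuous_on_compose2[OF h_cont v] by auto
  have "((\<lambda>x. flux v x / x ^ N) \<longlongrightarrow> h (v 0)) (at_right 0)"
  proof (rule lhopital_right_0)
    show "(flux v \<longlongrightarrow> 0) (at_right 0)"
      using continuous_on_flux[OF v, unfolded continuous_on_def, rule_format, of 0] at0 by simp
    have "((\<lambda>x::real. x ^ N) \<longlongrightarrow> 0 ^ N) (at_right 0)" by (intro tendsto_intros)
    then show "((\<lambda>x::real. x ^ N) \<longlongrightarrow> 0) (at_right 0)" using N by (simp add: power_0_left)
    show "eventually (\<lambda>x::real. x ^ N \<noteq> 0) (at_right 0)"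
      using ev by eventually_elim auto
    show "eventually (\<lambda>x::real. real N * x ^ (N - 1) \<noteq> 0) (at_right 0)"
      using ev by eventually_elim (use N in auto)
    show "eventually (\<lambda>x. (flux v has_real_derivative real N * x ^ (N - 1) * h (v x)) (at x)) (at_right 0)"
      using ev by eventually_elim (rule flux_has_derivative[OF v])
    show "eventually (\<lambda>x. ((\<lambda>x::real. x ^ N) has_real_derivative real N * x ^ (N - 1)) (at x)) (at_right 0)"
      by (intro always_eventually allI) (auto intro!: derivative_eq_intros)
    have "((\<lambda>t. h (v t)) \<longlongrightarrow> h (v 0)) (at_right 0)"
      using hv[unfolded continuous_on_def, rule_format, of 0] at0 by simp
    then show "((\<lambda>x. real N * x ^ (N - 1) * h (v x) / (real N * x ^ (N - 1))) \<longlongrightarrow> h (v 0)) (at_right 0)"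
      by (rule Lim_transform_eventually) (use ev in eventually_elim, use N in auto)
  qed
  then have "((\<lambda>x. root N (flux v x / x ^ N)) \<longlongrightarrow> root N (h (v 0))) (at_right 0)"
    by (rule tendsto_real_root)
  moreover have "eventually (\<lambda>x. root N (flux v x / x ^ N) = slope 0 v x / x) (at_right 0)"
    using ev by eventually_elim
      (use N in \<open>auto simp: slope_0_eq real_root_divide real_root_power_cancel\<close>)
  ultimately show ?thesis unfolding at0 by (rule Lim_transform_eventually)
qed

text \<open>The delicate point is a continuous second derivative up to \<open>0\<close>. For
  \<open>r > 0\<close> the chain rule gives
  \<open>w' r = r ^ (N - 1) * h (v r) / w r ^ (N - 1)\<close>, and dividing through by the power of
  \<open>r\<close> leaves an expression that extends continuously.\<close>

lemma positive_profile_of_fixed_point: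
  assumes v: "continuous_on {0..1} v"
    and fp: "\<And>r. r \<in> {0..1} \<Longrightarrow> v r = shoot 0 a v r"
    and v1: "v 1 = 0" and a: "0 < a" and h_pos: "\<And>s. 0 < s \<Longrightarrow> 0 < h s"
  shows "positive_profile N h v"
proof -
  define w where "w = slope 0 v"
  \<comment> \<open>The value at \<open>0\<close> is the limit of \<open>w r / r\<close>, so
    \<open>q\<close> is continuous and positive on \<open>[0, 1]\<close>.\<close>
  define q where "q r = (if r = 0 then root N (h a) else w r / r)" for r
  define w' where "w' r = h (v r) / q r ^ (N - 1)" for r
  have v0: "v 0 = a" using fp[of 0] by simp
  have fpos: "0 < flux v r" if "0 < r" "r \<le> 1" for r
    using flux_pos[OF v _ that] h_pos a v0 by simp
  have w_eq: "w r = root N (flux v r)" if "0 \<le> r" for r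
    using slope_0_eq[OF that] by (simp add: w_def)
  have wpos: "0 < w r" if "0 < r" "r \<le> 1" for r
    using fpos[OF that] that N by (simp add: w_eq)
  have wpow: "w r ^ N = flux v r" if "r \<in> {0..1}" for r
    using flux_nonneg[OF v, of r] that N by (simp add: w_eq)
  have vpos: "0 < v r" if "0 \<le> r" "r < 1" for r
  proof -
    \<comment> \<open>On \<open>[m, 1]\<close> the slope is at least \<open>w m > 0\<close>, which
      forces a strict drop to the value \<open>0\<close> at \<open>1\<close>; the midpoint also
      covers \<open>r = 0\<close>, where the slope itself vanishes.\<close>
    define m where "m = (r + 1) / 2"
    have m: "r < m" "m < 1" "0 < m" using that by (auto simp: m_def)
    have "w m * (1 - m) \<le> shoot 0 a v m - shoot 0 a v 1"
      unfolding w_def by (intro shoot_diff_ge slope_mono v) (use m in auto)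
    moreover have "0 < w m * (1 - m)" using wpos[of m] m by simp
    moreover have "shoot 0 a v m \<le> shoot 0 a v r"
      by (intro shoot_antimono v) (use m that in auto)
    ultimately show ?thesis using fp[of r] fp[of 1] v1 that by simp
  qed
  have q_lim: "((\<lambda>r. w r / r) \<longlongrightarrow> q 0) (at 0 within {0..1})"
    using slope_over_radius_tendsto[OF v] v0 by (simp add: w_def q_def)
  have w_cont: "continuous_on {0..1} w"
    unfolding w_def by (rule continuous_on_slope[OF v]) simp
  have q_cont: "continuous_on {0..1} q"
    unfolding continuous_on_def
  proof
    fix r :: real assume r: "r \<in> {0..1}"
    have "((\<lambda>r. w r / r) \<longlongrightarrow> q r) (at r within {0..1})"
    proof (cases "r = 0")
      case False
      have "(w \<longlongrightarrow> w r) (at r within {0..1})"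
        using w_cont r by (auto simp: continuous_on_def)
      then have "((\<lambda>r. w r / r) \<longlongrightarrow> w r / r) (at r within {0..1})"
        by (intro tendsto_intros False)
      then show ?thesis using False by (simp add: q_def)
    qed (use q_lim in simp)
    moreover have "eventually (\<lambda>x. w x / x = q x) (at r within {0..1})"
    proof (cases "r = 0")
      case True
      then show ?thesis by (auto simp: q_def eventually_at_filter)
    next
      case False
      have "eventually (\<lambda>x. x \<noteq> 0) (at r within {0..1})"
        using tendsto_imp_eventually_ne[OF tendsto_ident_at False] .
      then show ?thesis by eventually_elim (simp add: q_def)
    qed
    ultimately show "(q \<longlongrightarrow> q r) (at r within {0..1})"
      by (rule Lim_transform_eventually)
  qed
  have qpos: "0 < q r" if "r \<in> {0..1}" for r
    using wpos[of r] that h_pos[OF a] N by (auto simp: q_def)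
  have w'_cont: "continuous_on {0..1} w'"
    unfolding w'_def using qpos
    by (intro continuous_intros q_cont continuous_on_compose2[OF h_cont v]) (auto simp: less_imp_neq[symmetric])
  have v_deriv: "(v has_real_derivative - w r) (at r within {0..1})" if r: "r \<in> {0..1}" for r
  proof (rule has_field_derivative_transform_within[OF _ zero_less_one r])
    show "(shoot 0 a v has_real_derivative - w r) (at r within {0..1})"
      unfolding shoot_def[abs_def] w_def[symmetric]
      using integral_has_real_derivative[OF w_cont r] by (auto intro!: derivative_eq_intros)
  qed (simp add: fp)
  have w_deriv: "(w has_real_derivative w' r) (at r within {0..1})" if r: "r \<in> {0..1}" for r
  proof (cases "r = 0")
    case True
    \<comment> \<open>This reconciles the formula for \<open>w'\<close> at \<open>0\<close> with the
      difference quotient limit \<open>q 0\<close>.\<close>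
    have "q 0 ^ (N - 1) * q 0 = h a"
      using N h_pos[OF a] by (simp add: q_def power_minus_mult[of N] flip: power_Suc2)
    then have "w' 0 = q 0" using qpos[of 0] v0 by (simp add: w'_def field_simps)
    moreover have "w 0 = 0" by (simp add: w_eq)
    ultimately show ?thesis using q_lim True by (simp add: has_field_derivative_iff)
  next
    case False
    then have r0: "0 < r" "r \<le> 1" using r by auto
    have "((\<lambda>x. root N (flux v x)) has_real_derivative
        inverse (real N * root N (flux v r) ^ (N - Suc 0)) * (real N * r ^ (N - 1) * h (v r)))
        (at r within {0..1})"
      by (rule DERIV_chain2[OF DERIV_real_root flux_has_derivative_within[OF v r]])
         (use N fpos r0 in auto)
    moreover have "inverse (real N * root N (flux v r) ^ (N - Suc 0)) * (real N * r ^ (N - 1) * h (v r)) = w' r"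
      using r0 wpos[OF r0] N by (simp add: w'_def q_def w_eq[symmetric] field_simps power_divide)
    ultimately show ?thesis
      by (auto intro: has_field_derivative_transform_within[OF _ zero_less_one r] simp: w_eq)
  qed
  have w_mono: "w x < w y" if "0 < x" "x < y" "y < 1" for x y
  proof (rule DERIV_pos_imp_increasing[OF that(2)])
    fix z assume "x \<le> z" "z \<le> y"
    then have z: "0 < z" "z < 1" using that by auto
    have "(w has_real_derivative w' z) (at z)"
      using w_deriv[of z] z by (simp add: at_within_Icc_at)
    moreover have "0 < w' z"
      unfolding w'_def using h_pos[OF vpos[of z]] qpos[of z] z by simp
    ultimately show "\<exists>d. (w has_real_derivative d) (at z) \<and> 0 < d" by blast
  qed
  have "strict_concave_on {0<..<1} v"
    unfolding strict_concave_on_def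
  proof (rule strict_convex_on_deriv_strict_mono)
    show "((\<lambda>x. - v x) has_real_derivative w x) (at x)" if "x \<in> {0<..<1}" for x
      using DERIV_minus[OF v_deriv[of x]] that by (simp add: at_within_Icc_at)
  qed (use w_mono in auto)
  moreover have "((\<lambda>t. w t ^ N) has_real_derivative real N * r ^ (N - 1) * h (v r)) (at r)"
    if r: "r \<in> {0<..<1}" for r
    by (rule has_field_derivative_transform_within_open[OF flux_has_derivative[OF v r] _ r])
       (use wpow in auto)
  moreover have "w 0 = 0" by (simp add: w_eq)
  ultimately show ?thesis
    unfolding positive_profile_def
    by (intro conjI exI[where x = w] exI[where x = w'] ballI v_deriv w_deriv w'_cont vpos v1) auto
qed

end

section \<open>Two positive profiles for small \<open>lam\<close>\<close>

lemma positive_profile_cong: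
  assumes "positive_profile N h v" "\<And>r. r \<in> {0<..<1} \<Longrightarrow> h (v r) = k (v r)"
  shows "positive_profile N k v"
  using assms unfolding positive_profile_def by (metis (mono_tags, lifting))

text \<open>The threshold depends only on a bound \<open>G\<close> for \<open>g\<close> on
  \<open>[0, 1]\<close>, which controls the trajectories from \<open>1\<close>. The outer initial
  values \<open>a1\<close> and \<open>a2\<close> are chosen afterwards and may depend on
  \<open>lam\<close>.\<close>

lemma two_positive_profiles:
  fixes g :: "real \<Rightarrow> real"
  assumes N: "N \<ge> 1" and g_cont: "continuous_on {0..} g"
    and g_pos: "\<And>s. 0 < s \<Longrightarrow> 0 < g s"
    and g0: "filterlim (\<lambda>s. g s / s ^ N) at_top (at_right 0)"
    and ginf: "filterlim (\<lambda>s. g s / s ^ N) at_top at_top"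
  shows "\<exists>lp>0. \<forall>lam. 0 < lam \<and> lam < lp \<longrightarrow>
           (\<exists>v1 v2. positive_profile N (\<lambda>s. lam ^ N * g s) v1 \<and>
              positive_profile N (\<lambda>s. lam ^ N * g s) v2 \<and> v1 0 \<noteq> v2 0)"
proof -
  \<comment> \<open>The value at \<open>0\<close> is a limit of positive values; it is the value
    that the truncation uses for all negative arguments.\<close>
  have g_nonneg: "0 \<le> g s" if "0 \<le> s" for s
  proof (cases "s = 0")
    case True
    have "(g \<longlongrightarrow> g 0) (at_right 0)"
      using g_cont by (auto simp: continuous_on_def intro: tendsto_within_subset)
    moreover have "eventually (\<lambda>s. 0 \<le> g s) (at_right 0)"
      by (rule eventually_at_rightI[of 0 1]) (auto intro: less_imp_le[OF g_pos])
    ultimately have "0 \<le> g 0"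
      by (rule tendsto_lowerbound) simp
    then show ?thesis using True by simp
  next
    case False
    then show ?thesis using g_pos[of s] that by simp
  qed
  have bdd: "\<exists>G\<ge>0. \<forall>s\<in>{0..A}. g s \<le> G" for A
  proof -
    have "compact (g ` {0..A})"
      by (intro compact_continuous_image continuous_on_subset[OF g_cont]) auto
    then obtain G where "\<forall>y\<in>g ` {0..A}. norm y \<le> G"
      using compact_imp_bounded bounded_iff by blast
    then show ?thesis by (intro exI[of _ "\<bar>G\<bar>"]) force
  qed
  obtain G where G: "0 \<le> G" "\<And>s. s \<in> {0..1} \<Longrightarrow> g s \<le> G" using bdd by blast
  show ?thesis
  proof (intro exI[of _ "1 / (1 + G)"] conjI allI impI)
    show "0 < 1 / (1 + G)" using G by simp
    fix lam :: real
    assume lam: "0 < lam \<and> lam < 1 / (1 + G)"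
    \<comment> \<open>Chosen so that \<open>lam ^ N * M * s ^ N = (18 * s) ^ N\<close>, which
      dominates \<open>(9 * a) ^ N\<close> as soon as \<open>s \<ge> a / 2\<close>.\<close>
    define M where "M = (18 / lam) ^ N"
    have low: "(9 * a) ^ N \<le> lam ^ N * g s" if "0 < a" "a / 2 \<le> s" "M \<le> g s / s ^ N" for a s
    proof -
      have s: "0 < s" using that by linarith
      have "(9 * a) ^ N \<le> (18 * s) ^ N" using that by (intro power_mono) auto
      also have "\<dots> = lam ^ N * (M * s ^ N)"
        using lam by (simp add: M_def power_divide power_mult_distrib)
      also have "\<dots> \<le> lam ^ N * g s"
        using that s lam by (intro mult_left_mono) (auto simp: field_simps)
      finally show ?thesis .
    qed
    have "eventually (\<lambda>s. M \<le> g s / s ^ N) (at_right 0)"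
      using g0 by (simp add: filterlim_at_top)
    then obtain b where b: "0 < b" "\<And>s. 0 < s \<Longrightarrow> s < b \<Longrightarrow> M \<le> g s / s ^ N"
      by (auto simp: eventually_at_right_field)
    have "eventually (\<lambda>s. M \<le> g s / s ^ N) at_top"
      using ginf by (simp add: filterlim_at_top)
    then obtain K where K: "\<And>s. K \<le> s \<Longrightarrow> M \<le> g s / s ^ N"
      by (auto simp: eventually_at_top_linorder)
    \<comment> \<open>The interval \<open>[a1 / 2, a1]\<close> lies in the range
      \<open>(0, b)\<close> and below \<open>1\<close>; \<open>[a2 / 2, a2]\<close> lies beyond
      \<open>K\<close>, and \<open>a2\<close> exceeds \<open>1\<close>.\<close>
    define a1 where "a1 = min (b / 2) (1 / 2)"
    define a2 where "a2 = max 2 (2 * K)"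
    have a1: "0 < a1" "a1 < b" "a1 \<le> 1 / 2" using b by (auto simp: a1_def)
    have a2: "2 \<le> a2" "2 * K \<le> a2" by (auto simp: a2_def)
    \<comment> \<open>Clamping the argument to \<open>[0, a2]\<close> makes the nonlinearity
      bounded. The profiles found below take values in this interval, so they solve the original
      equation.\<close>
    define h where "h s = lam ^ N * g (max 0 (min a2 s))" for s
    have h_eq: "h s = lam ^ N * g s" if "0 \<le> s" "s \<le> a2" for s
      using that by (simp add: h_def)
    obtain B where B: "0 \<le> B" "\<And>s. s \<in> {0..a2} \<Longrightarrow> g s \<le> B" using bdd by blast
    interpret delayed_shooting N h "lam ^ N * B"
    proof
      show "continuous_on UNIV h"
        unfolding h_def by (intro continuous_intros continuous_on_compose2[OF g_cont]) auto
      show "0 \<le> h s" for s unfolding h_def using lam by (simp add: g_nonneg)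
      show "h s \<le> lam ^ N * B" for s
        unfolding h_def using lam a2 by (intro mult_left_mono B) auto
    qed (rule N)
    \<comment> \<open>This holds because \<open>lam < 1 / (1 + G) \<le> 1\<close> and
      \<open>N \<ge> 1\<close>.\<close>
    have "lam ^ N \<le> lam"
      using power_decreasing[OF N, of lam] lam G
      by (smt (verit, best) divide_le_eq_1 power_one_right)
    then have "lam ^ N * G \<le> lam * G" using G by (intro mult_right_mono) auto
    also have "\<dots> < 1"
      using lam G by (simp add: pos_less_divide_eq) (simp add: algebra_simps)
    finally have c1: "root N (lam ^ N * G) < 1" using N by simp
    have c2: "h s \<le> lam ^ N * G" if "s \<le> 1" for s
      unfolding h_def using that lam a2 by (intro mult_left_mono G) auto
    have c0: "0 \<le> lam ^ N * G" using lam G by simp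
    have h_pos: "0 < h s" if "0 < s" for s
      unfolding h_def using that lam a2 g_pos by simp
    have prof: "positive_profile N (\<lambda>s. lam ^ N * g s) v"
      if "continuous_on {0..1} v" "\<forall>r\<in>{0..1}. v r = shoot 0 a v r" "v 1 = 0" "0 < a" "a \<le> a2" for a v
    proof -
      have pp: "positive_profile N h v"
        by (rule positive_profile_of_fixed_point[OF that(1) _ that(3,4) h_pos]) (use that(2) in blast)
      show ?thesis
      proof (rule positive_profile_cong[OF pp])
        fix r :: real assume r: "r \<in> {0<..<1}"
        then have "0 < v r" using pp by (simp add: positive_profile_def)
        moreover have "v r \<le> a"
          using shoot_antimono[OF that(1) order_refl, of 0 r a] bspec[OF that(2), of r] r by simp
        ultimately show "h (v r) = lam ^ N * g (v r)" using that by (intro h_eq) auto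
      qed
    qed
    have h1: "(9 * a1) ^ N \<le> h s" if "a1 / 2 \<le> s" "s \<le> a1" for s
    proof -
      have "h s = lam ^ N * g s" by (rule h_eq) (use that a1 a2 in auto)
      then show ?thesis using low[OF a1(1) that(1) b(2)] that a1 by simp
    qed
    have h2: "(9 * a2) ^ N \<le> h s" if "a2 / 2 \<le> s" "s \<le> a2" for s
    proof -
      have "h s = lam ^ N * g s" by (rule h_eq) (use that a2 in auto)
      then show ?thesis using low[OF _ that(1) K] that a2 by simp
    qed
    obtain p v1 where v1: "p \<in> closed_segment a1 1 - {1}" "continuous_on {0..1} v1"
      "\<forall>r\<in>{0..1}. v1 r = shoot 0 p v1 r" "v1 1 = 0"
      using solution_exists[OF a1(1) h1 c0 c2 c1] by blast
    obtain q v2 where v2: "q \<in> closed_segment a2 1 - {1}" "continuous_on {0..1} v2"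
      "\<forall>r\<in>{0..1}. v2 r = shoot 0 q v2 r" "v2 1 = 0"
      using solution_exists[OF _ h2 c0 c2 c1] a2 by fastforce
    have p: "0 < p" "p < 1" using v1(1) a1 by (auto simp: closed_segment_eq_real_ivl split: if_splits)
    have q: "1 < q" "q \<le> a2" using v2(1) a2 by (auto simp: closed_segment_eq_real_ivl split: if_splits)
    have "v1 0 = p" "v2 0 = q" using bspec[OF v1(3), of 0] bspec[OF v2(3), of 0] by simp_all
    then have "v1 0 \<noteq> v2 0" using p q by simp
    then show "\<exists>v1 v2. positive_profile N (\<lambda>s. lam ^ N * g s) v1 \<and>
              positive_profile N (\<lambda>s. lam ^ N * g s) v2 \<and> v1 0 \<noteq> v2 0"
      using prof[OF v1(2-4) p(1)] prof[OF v2(2-4) _ q(2)] p q a2 by fastforce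
  qed
qed

section \<open>Return to signed solutions of the original problem\<close>

lemma MO_solution_of_profile:
  assumes prof: "positive_profile N (\<lambda>s. lam ^ N * (\<sigma> ^ N * f (\<sigma> * s))) v"
    and \<sigma>: "\<sigma> = 1 \<or> \<sigma> = - 1"
  shows "MO_solution N f lam (\<lambda>r. - \<sigma> * v r)"
proof -
  obtain w w' where w: "v 1 = 0" "\<And>r. r \<in> {0..1} \<Longrightarrow> (v has_real_derivative - w r) (at r within {0..1})"
    "\<And>r. r \<in> {0..1} \<Longrightarrow> (w has_real_derivative w' r) (at r within {0..1})"
    "continuous_on {0..1} w'" "w 0 = 0"
    "\<And>r. r \<in> {0<..<1} \<Longrightarrow> ((\<lambda>t. w t ^ N) has_real_derivative
            real N * r ^ (N - 1) * (lam ^ N * (\<sigma> ^ N * f (\<sigma> * v r)))) (at r)"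
    using prof unfolding positive_profile_def by blast
  \<comment> \<open>One factor \<open>\<sigma> ^ N\<close> comes from the power of
    \<open>\<sigma> * w\<close>, the other from the reflected nonlinearity; they cancel for either
    parity of \<open>N\<close>.\<close>
  have sq: "\<sigma> ^ N * \<sigma> ^ N = 1"
    using \<sigma> by (auto simp flip: power_mult_distrib)
  show ?thesis
    unfolding MO_solution_def
  proof (rule exI[of _ "\<lambda>r. \<sigma> * w r"], rule exI[of _ "\<lambda>r. \<sigma> * w' r"], intro conjI ballI)
    fix r :: real
    assume r: "r \<in> {0..1}"
    show "((\<lambda>r. - \<sigma> * v r) has_real_derivative \<sigma> * w r) (at r within {0..1})"
      using DERIV_cmult[OF w(2)[OF r], of "- \<sigma>"] by simp
    show "((\<lambda>r. \<sigma> * w r) has_real_derivative \<sigma> * w' r) (at r within {0..1})"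
      by (rule DERIV_cmult[OF w(3)[OF r]])
  next
    fix r :: real
    assume r: "r \<in> {0<..<1}"
    have eq: "\<sigma> ^ N * (real N * r ^ (N - 1) * (lam ^ N * (\<sigma> ^ N * f (\<sigma> * v r))))
        = (\<sigma> ^ N * \<sigma> ^ N) * (lam ^ N * real N * r ^ (N - 1) * f (- (- \<sigma> * v r)))"
      by (simp add: mult_ac)
    show "((\<lambda>t. (\<sigma> * w t) ^ N) has_real_derivative
        lam ^ N * real N * r ^ (N - 1) * f (- (- \<sigma> * v r))) (at r)"
      unfolding power_mult_distrib
      by (rule DERIV_cong[OF DERIV_cmult[OF w(6)[OF r]]]) (simp only: eq sq mult_1_left)
  qed (use w in \<open>auto intro!: continuous_intros\<close>)
qed

text \<open>Since \<open>g s / s ^ N = f (\<sigma> * s) / (\<sigma> * s) ^ N\<close>, the two growth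
  conditions and the sign condition on \<open>f\<close> pass to \<open>g\<close> for both choices of
  \<open>\<sigma>\<close>.\<close>

lemma two_signed_solutions:
  fixes f :: "real \<Rightarrow> real"
  assumes N: "N \<ge> 1"
    and f_cont: "continuous_on UNIV f"
    and f_sign: "\<forall>s. s \<noteq> 0 \<longrightarrow> f s * s ^ N > 0"
    and f0: "filterlim (\<lambda>s. f s / s ^ N) at_top (at 0)"
    and finf: "filterlim (\<lambda>s. f s / s ^ N) at_top at_infinity"
    and \<sigma>: "\<sigma> = 1 \<or> \<sigma> = - 1"
  shows "\<exists>lp>0. \<forall>lam. 0 < lam \<and> lam < lp \<longrightarrow>
           (\<exists>v1 v2. MO_solution N f lam (\<lambda>r. - \<sigma> * v1 r) \<and> MO_solution N f lam (\<lambda>r. - \<sigma> * v2 r) \<and>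
              v1 0 \<noteq> v2 0 \<and> (\<forall>r\<in>{0<..<1}. 0 < v1 r \<and> 0 < v2 r) \<and>
              strict_concave_on {0<..<1} v1 \<and> strict_concave_on {0<..<1} v2)"
proof -
  define g where "g s = \<sigma> ^ N * f (\<sigma> * s)" for s
  have sq: "\<sigma> ^ N * \<sigma> ^ N = 1"
    using \<sigma> by (auto simp flip: power_mult_distrib)
  have ratio: "g s / s ^ N = f (\<sigma> * s) / (\<sigma> * s) ^ N" for s
  proof -
    have "\<sigma> \<noteq> 0" using \<sigma> by auto
    then have "f (\<sigma> * s) / (\<sigma> * s) ^ N = (\<sigma> ^ N * \<sigma> ^ N) * f (\<sigma> * s) / (\<sigma> * s) ^ N"
      by (simp add: sq)
    also have "\<dots> = g s / s ^ N"
      using \<open>\<sigma> \<noteq> 0\<close> by (simp add: g_def power_mult_distrib)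
    finally show ?thesis by simp
  qed
  have g_cont: "continuous_on {0..} g"
    unfolding g_def by (intro continuous_intros continuous_on_compose2[OF f_cont]) auto
  have g_pos: "0 < g s" if "0 < s" for s
  proof -
    have "0 < f (\<sigma> * s) * (\<sigma> * s) ^ N" using f_sign \<sigma> that by auto
    then have "0 < g s * s ^ N" by (simp add: g_def power_mult_distrib mult_ac)
    then show ?thesis using that by (simp add: zero_less_mult_iff)
  qed
  have g0: "filterlim (\<lambda>s. g s / s ^ N) at_top (at_right 0)"
    unfolding ratio
  proof (rule filterlim_compose[OF f0])
    show "filterlim (\<lambda>s. \<sigma> * s) (at 0) (at_right 0)"
      unfolding filterlim_at
    proof
      show "eventually (\<lambda>s. \<sigma> * s \<in> UNIV \<and> \<sigma> * s \<noteq> 0) (at_right 0)"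
        using \<sigma> by (auto simp: eventually_at_filter)
      show "((\<lambda>s. \<sigma> * s) \<longlongrightarrow> 0) (at_right 0)"
        by (rule tendsto_mult_right_zero) (rule tendsto_ident_at)
    qed
  qed
  have ginf: "filterlim (\<lambda>s. g s / s ^ N) at_top at_top"
    unfolding ratio
  proof (rule filterlim_compose[OF finf])
    have "filterlim (\<lambda>s. norm (\<sigma> * s)) at_top at_top"
      using \<sigma> filterlim_abs_real by (auto simp: abs_mult)
    then show "filterlim (\<lambda>s. \<sigma> * s) at_infinity at_top"
      by (rule filterlim_norm_at_top_imp_at_infinity)
  qed
  obtain lp where lp: "0 < lp" "\<And>lam. 0 < lam \<Longrightarrow> lam < lp \<Longrightarrow>
      \<exists>v1 v2. positive_profile N (\<lambda>s. lam ^ N * g s) v1 \<and>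
              positive_profile N (\<lambda>s. lam ^ N * g s) v2 \<and> v1 0 \<noteq> v2 0"
    using two_positive_profiles[OF N g_cont g_pos g0 ginf] by blast
  show ?thesis
  proof (intro exI[of _ lp] conjI lp(1) allI impI)
    fix lam assume "0 < lam \<and> lam < lp"
    then obtain v1 v2 where v: "positive_profile N (\<lambda>s. lam ^ N * g s) v1"
      "positive_profile N (\<lambda>s. lam ^ N * g s) v2" "v1 0 \<noteq> v2 0"
      using lp(2) by blast
    have "MO_solution N f lam (\<lambda>r. - \<sigma> * v1 r)" "MO_solution N f lam (\<lambda>r. - \<sigma> * v2 r)"
      by (rule MO_solution_of_profile[OF v(1)[unfolded g_def] \<sigma>],
          rule MO_solution_of_profile[OF v(2)[unfolded g_def] \<sigma>])
    moreover have "\<forall>r\<in>{0<..<1}. 0 < v1 r \<and> 0 < v2 r"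
      "strict_concave_on {0<..<1} v1" "strict_concave_on {0<..<1} v2"
      using v(1,2) by (auto simp: positive_profile_def)
    ultimately show "\<exists>v1 v2. MO_solution N f lam (\<lambda>r. - \<sigma> * v1 r) \<and> MO_solution N f lam (\<lambda>r. - \<sigma> * v2 r) \<and>
              v1 0 \<noteq> v2 0 \<and> (\<forall>r\<in>{0<..<1}. 0 < v1 r \<and> 0 < v2 r) \<and>
              strict_concave_on {0<..<1} v1 \<and> strict_concave_on {0<..<1} v2"
      using v(3) by blast
  qed
qed

theorem theorem4p9:
  fixes N :: nat and f :: "real \<Rightarrow> real"
  assumes N: "N \<ge> 1"
    and f_cont: "continuous_on UNIV f"
    and f_sign: "\<forall>s. s \<noteq> 0 \<longrightarrow> f s * s ^ N > 0"
    and f0: "filterlim (\<lambda>s. f s / s ^ N) at_top (at 0)"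
    and finf: "filterlim (\<lambda>s. f s / s ^ N) at_top at_infinity"
  shows "(\<exists>lp > 0. \<forall>lam. 0 < lam \<and> lam < lp \<longrightarrow>
            (\<exists>u1 u2. MO_solution N f lam u1 \<and> MO_solution N f lam u2 \<and>
               (\<exists>r\<in>{0..1}. u1 r \<noteq> u2 r) \<and>
               (\<forall>r\<in>{0<..<1}. u1 r > 0 \<and> u2 r > 0) \<and>
               strict_concave_on {0<..<1} u1 \<and> strict_concave_on {0<..<1} u2))
       \<and> (\<exists>lm > 0. \<forall>lam. 0 < lam \<and> lam < lm \<longrightarrow>
            (\<exists>u1 u2. MO_solution N f lam u1 \<and> MO_solution N f lam u2 \<and>
               (\<exists>r\<in>{0..1}. u1 r \<noteq> u2 r) \<and>
               (\<forall>r\<in>{0<..<1}. u1 r < 0 \<and> u2 r < 0) \<and>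
               strict_convex_on {0<..<1} u1 \<and> strict_convex_on {0<..<1} u2))"
proof (rule conjI)
  \<comment> \<open>The two solutions are told apart by their values at
    \<open>r = 0\<close>.\<close>
  have z: "(0::real) \<in> {0..1}" by simp
  obtain lp where lp: "0 < lp" "\<And>lam. 0 < lam \<Longrightarrow> lam < lp \<Longrightarrow>
      \<exists>v1 v2. MO_solution N f lam v1 \<and> MO_solution N f lam v2 \<and>
              v1 0 \<noteq> v2 0 \<and> (\<forall>r\<in>{0<..<1}. 0 < v1 r \<and> 0 < v2 r) \<and>
              strict_concave_on {0<..<1} v1 \<and> strict_concave_on {0<..<1} v2"
    using two_signed_solutions[OF assms, of "- 1"] by auto
  show "\<exists>lp > 0. \<forall>lam. 0 < lam \<and> lam < lp \<longrightarrow>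
            (\<exists>u1 u2. MO_solution N f lam u1 \<and> MO_solution N f lam u2 \<and>
               (\<exists>r\<in>{0..1}. u1 r \<noteq> u2 r) \<and>
               (\<forall>r\<in>{0<..<1}. u1 r > 0 \<and> u2 r > 0) \<and>
               strict_concave_on {0<..<1} u1 \<and> strict_concave_on {0<..<1} u2)"
  proof (intro exI[of _ lp] conjI lp(1) allI impI)
    fix lam assume "0 < lam \<and> lam < lp"
    then obtain v1 v2 where v: "MO_solution N f lam v1" "MO_solution N f lam v2"
      "v1 0 \<noteq> v2 0" "\<forall>r\<in>{0<..<1}. 0 < v1 r \<and> 0 < v2 r"
      "strict_concave_on {0<..<1} v1" "strict_concave_on {0<..<1} v2"
      using lp(2) by blast
    show "\<exists>u1 u2. MO_solution N f lam u1 \<and> MO_solution N f lam u2 \<and>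
               (\<exists>r\<in>{0..1}. u1 r \<noteq> u2 r) \<and>
               (\<forall>r\<in>{0<..<1}. u1 r > 0 \<and> u2 r > 0) \<and>
               strict_concave_on {0<..<1} u1 \<and> strict_concave_on {0<..<1} u2"
      by (rule exI[of _ v1], rule exI[of _ v2]) (intro conjI v bexI[of "\<lambda>r. v1 r \<noteq> v2 r", OF v(3) z])
  qed
  obtain lm where lm: "0 < lm" "\<And>lam. 0 < lam \<Longrightarrow> lam < lm \<Longrightarrow>
      \<exists>v1 v2. MO_solution N f lam (\<lambda>r. - v1 r) \<and> MO_solution N f lam (\<lambda>r. - v2 r) \<and>
              v1 0 \<noteq> v2 0 \<and> (\<forall>r\<in>{0<..<1}. 0 < v1 r \<and> 0 < v2 r) \<and>
              strict_concave_on {0<..<1} v1 \<and> strict_concave_on {0<..<1} v2"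
    using two_signed_solutions[OF assms, of 1] by auto
  show "\<exists>lm > 0. \<forall>lam. 0 < lam \<and> lam < lm \<longrightarrow>
            (\<exists>u1 u2. MO_solution N f lam u1 \<and> MO_solution N f lam u2 \<and>
               (\<exists>r\<in>{0..1}. u1 r \<noteq> u2 r) \<and>
               (\<forall>r\<in>{0<..<1}. u1 r < 0 \<and> u2 r < 0) \<and>
               strict_convex_on {0<..<1} u1 \<and> strict_convex_on {0<..<1} u2)"
  proof (intro exI[of _ lm] conjI lm(1) allI impI)
    fix lam assume "0 < lam \<and> lam < lm"
    then obtain v1 v2 where v: "MO_solution N f lam (\<lambda>r. - v1 r)" "MO_solution N f lam (\<lambda>r. - v2 r)"
      "v1 0 \<noteq> v2 0" "\<forall>r\<in>{0<..<1}. 0 < v1 r \<and> 0 < v2 r"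
      "strict_concave_on {0<..<1} v1" "strict_concave_on {0<..<1} v2"
      using lm(2) by blast
    show "\<exists>u1 u2. MO_solution N f lam u1 \<and> MO_solution N f lam u2 \<and>
               (\<exists>r\<in>{0..1}. u1 r \<noteq> u2 r) \<and>
               (\<forall>r\<in>{0<..<1}. u1 r < 0 \<and> u2 r < 0) \<and>
               strict_convex_on {0<..<1} u1 \<and> strict_convex_on {0<..<1} u2"
      by (rule exI[of _ "\<lambda>r. - v1 r"], rule exI[of _ "\<lambda>r. - v2 r"])
         (use v z in \<open>auto simp: strict_concave_on_def\<close>)
  qed
qed

end
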